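(* Let $G$ be a maximal $3$-$\gamma_{c}$-vertex critical graph with independence number $\alpha$ and connectivity $\kappa$. If $\alpha=\kappa$, then for every minimum vertex cut set $S$ of $G$ (i.e. $|S|=\kappa$ and $G-S$ is disconnected), the graph $G-S$ has at least one component consisting of a single vertex.
   Context: All graphs are finite, simple and connected. A set $D\subseteq V(G)$ is a connected dominating set of $G$ if every vertex of $G$ is in $D$ or adjacent to a vertex of $D$, and $G[D]$ is connected; $\gamma_{c}(G)$ is the minimum cardinality of such a set. $G$ is $k$-$\gamma_{c}$-edge critical if $\gamma_{c}(G)=k$ and $\gamma_{c}(G+uv)<k$ for every pair of non-adjacent vertices $u,v$. A $2$-connected graph $G$ is $k$-$\gamma_{c}$-vertex critical if $\gamma_{c}(G)=k$ and $\gamma_{c}(G-v)<k$ for every $v\in V(G)$. $G$ is maximal $k$-$\gamma_{c}$-vertex critical if it is both $k$-$\gamma_{c}$-edge critical and $k$-$\gamma_{c}$-vertex critical. *)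

theory Defs
  imports Main
begin

definition simple_graph :: "'a set \<Rightarrow> ('a \<Rightarrow> 'a \<Rightarrow> bool) \<Rightarrow> bool" where
  "simple_graph V E \<longleftrightarrow> finite V \<and>
     (\<forall>x y. E x y \<longrightarrow> x \<in> V \<and> y \<in> V \<and> x \<noteq> y \<and> E y x)"

definition induced :: "('a \<Rightarrow> 'a \<Rightarrow> bool) \<Rightarrow> 'a set \<Rightarrow> 'a \<Rightarrow> 'a \<Rightarrow> bool" where
  "induced E W = (\<lambda>x y. E x y \<and> x \<in> W \<and> y \<in> W)"

definition conn_on :: "('a \<Rightarrow> 'a \<Rightarrow> bool) \<Rightarrow> 'a set \<Rightarrow> bool" where
  "conn_on E W \<longleftrightarrow> W \<noteq> {} \<and> (\<forall>x\<in>W. \<forall>y\<in>W. (induced E W)\<^sup>*\<^sup>* x y)"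

definition is_component :: "('a \<Rightarrow> 'a \<Rightarrow> bool) \<Rightarrow> 'a set \<Rightarrow> 'a set \<Rightarrow> bool" where
  "is_component E W C \<longleftrightarrow> C \<subseteq> W \<and> conn_on E C \<and>
     (\<forall>C'. C \<subseteq> C' \<and> C' \<subseteq> W \<and> conn_on E C' \<longrightarrow> C' = C)"

definition conn_dom_set :: "'a set \<Rightarrow> ('a \<Rightarrow> 'a \<Rightarrow> bool) \<Rightarrow> 'a set \<Rightarrow> bool" where
  "conn_dom_set V E D \<longleftrightarrow> D \<subseteq> V \<and> (\<forall>v\<in>V. v \<in> D \<or> (\<exists>u\<in>D. E u v)) \<and> conn_on E D"

definition gamma_c :: "'a set \<Rightarrow> ('a \<Rightarrow> 'a \<Rightarrow> bool) \<Rightarrow> nat" where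
  "gamma_c V E = Min {card D | D. conn_dom_set V E D}"

definition del_vertex :: "('a \<Rightarrow> 'a \<Rightarrow> bool) \<Rightarrow> 'a \<Rightarrow> 'a \<Rightarrow> 'a \<Rightarrow> bool" where
  "del_vertex E v = (\<lambda>x y. E x y \<and> x \<noteq> v \<and> y \<noteq> v)"

definition add_edge :: "('a \<Rightarrow> 'a \<Rightarrow> bool) \<Rightarrow> 'a \<Rightarrow> 'a \<Rightarrow> 'a \<Rightarrow> 'a \<Rightarrow> bool" where
  "add_edge E u v = (\<lambda>x y. E x y \<or> (x = u \<and> y = v) \<or> (x = v \<and> y = u))"

definition k_connected :: "nat \<Rightarrow> 'a set \<Rightarrow> ('a \<Rightarrow> 'a \<Rightarrow> bool) \<Rightarrow> bool" where
  "k_connected k V E \<longleftrightarrow> card V > k \<and>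
     (\<forall>X. X \<subseteq> V \<and> card X < k \<longrightarrow> conn_on E (V - X))"

definition edge_critical :: "nat \<Rightarrow> 'a set \<Rightarrow> ('a \<Rightarrow> 'a \<Rightarrow> bool) \<Rightarrow> bool" where
  "edge_critical k V E \<longleftrightarrow> gamma_c V E = k \<and>
     (\<forall>u\<in>V. \<forall>v\<in>V. u \<noteq> v \<and> \<not> E u v \<longrightarrow> gamma_c V (add_edge E u v) < k)"

definition vertex_critical :: "nat \<Rightarrow> 'a set \<Rightarrow> ('a \<Rightarrow> 'a \<Rightarrow> bool) \<Rightarrow> bool" where
  "vertex_critical k V E \<longleftrightarrow> k_connected 2 V E \<and> gamma_c V E = k \<and>
     (\<forall>v\<in>V. gamma_c (V - {v}) (del_vertex E v) < k)"

definition maximal_vertex_critical :: "nat \<Rightarrow> 'a set \<Rightarrow> ('a \<Rightarrow> 'a \<Rightarrow> bool) \<Rightarrow> bool" where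
  "maximal_vertex_critical k V E \<longleftrightarrow> edge_critical k V E \<and> vertex_critical k V E"

definition independent :: "('a \<Rightarrow> 'a \<Rightarrow> bool) \<Rightarrow> 'a set \<Rightarrow> bool" where
  "independent E I \<longleftrightarrow> (\<forall>x\<in>I. \<forall>y\<in>I. \<not> E x y)"

definition indep_number :: "'a set \<Rightarrow> ('a \<Rightarrow> 'a \<Rightarrow> bool) \<Rightarrow> nat" where
  "indep_number V E = Max {card I | I. I \<subseteq> V \<and> independent E I}"

definition vertex_cut :: "'a set \<Rightarrow> ('a \<Rightarrow> 'a \<Rightarrow> bool) \<Rightarrow> 'a set \<Rightarrow> bool" where
  "vertex_cut V E S \<longleftrightarrow> S \<subseteq> V \<and> V - S \<noteq> {} \<and> \<not> conn_on E (V - S)"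

definition connectivity :: "'a set \<Rightarrow> ('a \<Rightarrow> 'a \<Rightarrow> bool) \<Rightarrow> nat" where
  "connectivity V E = Min {card S | S. S \<subseteq> V \<and>
      (card (V - S) \<le> 1 \<or> \<not> conn_on E (V - S))}"

end

theory Submission
  imports Defs
begin

text \<open>
  Suppose that \<open>G - S\<close> has no singleton component and write \<open>V - S\<close> as a union of nonempty parts
  \<open>A\<close>, \<open>B\<close> with no edges between them. Vertex criticality gives for every \<open>v\<close> an edge \<open>pq\<close> that
  dominates exactly \<open>V - {v}\<close>, and such an edge must meet \<open>S\<close>. If \<open>|S| = 2\<close>, each vertex of \<open>S\<close>
  is complete to \<open>A\<close> or to \<open>B\<close> because \<open>\<alpha> = 2\<close>, and this rules out such an edge for \<open>v \<in> A\<close>.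
  If \<open>|S| \<ge> 3\<close>, take an independent set \<open>I\<close> with \<open>|I| = |S|\<close>. By edge criticality, for any two
  \<open>u, v \<in> I\<close> some edge \<open>uw\<close> dominates exactly \<open>V - {v}\<close>, or with the roles of \<open>u\<close> and \<open>v\<close>
  exchanged; then \<open>w\<close> is adjacent to all of \<open>I\<close> except the missed vertex \<open>v\<close>, so \<open>w\<close> determines
  \<open>v\<close>. For \<open>u \<in> T = I - S\<close> moreover \<open>w \<in> Y = S - I\<close>, and \<open>|Y| = |T|\<close>. Either every vertex of \<open>T\<close> is
  missed from within \<open>T\<close>; then \<open>Y\<close> consists of these \<open>w\<close> and is a clique, which contradicts the
  criticality of its vertices. Or some \<open>x \<in> T\<close> is not, and then all of \<open>Y\<close> but one vertex \<open>z\<close> is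
  given by the edges at \<open>x\<close> missing the vertices of \<open>T - {x}\<close>. The critical edges of the vertices
  of \<open>Y\<close>, of \<open>x\<close>, and of vertices of \<open>A\<close> and \<open>B\<close> outside \<open>I\<close> then contradict each other.
\<close>

section \<open>Edges that dominate all vertices but one, and the two sides of the cut\<close>

definition dominates_but :: "'a set \<Rightarrow> ('a \<Rightarrow> 'a \<Rightarrow> bool) \<Rightarrow> 'a \<Rightarrow> 'a \<Rightarrow> 'a \<Rightarrow> bool" where
  "dominates_but V E v p q \<longleftrightarrow> v \<in> V \<and> p \<in> V \<and> q \<in> V \<and> p \<noteq> v \<and> q \<noteq> v \<and>
     E p q \<and> \<not> E p v \<and> \<not> E q v \<and> (\<forall>x\<in>V. x = v \<or> x = p \<or> x = q \<or> E p x \<or> E q x)"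

text \<open>The axiom \<open>no_isolated\<close> is the negated conclusion. Neither side need be
  connected, and the axioms are symmetric in \<open>A\<close> and \<open>B\<close>, so
  \<open>flip\<close> transfers results between the sides.\<close>

locale split_graph =
  fixes V :: "'a set" and E :: "'a \<Rightarrow> 'a \<Rightarrow> bool" and S A B :: "'a set"
  assumes finV: "finite V"
    and sym: "E x y \<Longrightarrow> E y x"
    and irr: "\<not> E x x"
    and V_eq: "V = S \<union> A \<union> B"
    and disj: "S \<inter> A = {}" "S \<inter> B = {}" "A \<inter> B = {}"
    and nonempty: "A \<noteq> {}" "B \<noteq> {}"
    and sep: "a \<in> A \<Longrightarrow> b \<in> B \<Longrightarrow> \<not> E a b"
    and no_isolated: "v \<in> A \<union> B \<Longrightarrow> \<exists>u \<in> A \<union> B. E v u"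
    and vertex_crit: "v \<in> V \<Longrightarrow> \<exists>p q. dominates_but V E v p q"
begin

lemma flip: "split_graph V E S B A"
proof
  show "V = S \<union> B \<union> A" "B \<inter> A = {}" using V_eq disj by blast+
  show "\<not> E a b" if "a \<in> B" "b \<in> A" for a b using sep sym that by blast
  show "\<exists>u\<in>B \<union> A. E v u" if "v \<in> B \<union> A" for v using no_isolated that by blast
qed (fact finV irr disj nonempty vertex_crit sym)+

abbreviation dom where "dom \<equiv> dominates_but V E"

lemma dom_commute: "dom v p q \<Longrightarrow> dom v q p"
  unfolding dominates_but_def using sym by blast

lemma domD:
  assumes "dom v p q"
  shows "v \<in> V" "p \<in> V" "q \<in> V" "p \<noteq> v" "q \<noteq> v" "E p q" "E q p" "p \<noteq> q"
    "\<not> E p v" "\<not> E q v" "\<not> E v p" "\<not> E v q"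
  using assms sym irr unfolding dominates_but_def by blast+

lemma dom_covers:
  "dom v p q \<Longrightarrow> x \<in> V \<Longrightarrow> x \<noteq> v \<Longrightarrow> x \<noteq> p \<Longrightarrow> x \<noteq> q \<Longrightarrow> \<not> E p x \<Longrightarrow> E q x"
  unfolding dominates_but_def by blast

lemma edge_in_A:
  assumes "E x y" "x \<in> A" "y \<in> V" "y \<notin> S" shows "y \<in> A"
  using assms sep V_eq by blast

lemma edge_in_B:
  assumes "E x y" "x \<in> B" "y \<in> V" "y \<notin> S" shows "y \<in> B"
  using assms sep sym V_eq by blast

text \<open>A pair with \<open>dom v p q\<close> is called a critical pair of \<open>v\<close>
  below. If it avoided \<open>S\<close>, it would lie in one side; the other side has two vertices
  by \<open>no_isolated\<close>, so one different from \<open>v\<close> would stay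
  undominated.\<close>

lemma dom_meets_S:
  assumes "dom v p q" shows "p \<in> S \<or> q \<in> S"
proof (rule ccontr)
  assume no: "\<not> (p \<in> S \<or> q \<in> S)"
  have other_side: "\<exists>u\<in>X. u \<noteq> v" if X: "X = A \<or> X = B" for X
  proof -
    obtain u where u: "u \<in> X" using X nonempty by blast
    then obtain u' where "u' \<in> A \<union> B" "E u u'" using X u no_isolated by blast
    then have "u' \<in> X" "u' \<noteq> u" using u X sep sym irr by blast+
    then show ?thesis using u by (cases "u = v") auto
  qed
  show False
  proof (cases "p \<in> A")
    case True
    then have "q \<in> A" using no domD[OF assms] edge_in_A by blast
    moreover obtain b where "b \<in> B" "b \<noteq> v" using other_side by blast
    ultimately show False using dom_covers[OF assms, of b] True V_eq sep disj by blast
  next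
    case False
    then have p: "p \<in> B" using no domD(2)[OF assms] V_eq by blast
    then have "q \<in> B" using no domD[OF assms] edge_in_B by blast
    moreover obtain a where "a \<in> A" "a \<noteq> v" using other_side by blast
    ultimately show False using dom_covers[OF assms, of a] p V_eq sep sym disj by blast
  qed
qed

lemma crit_pair_in_S:
  assumes "v \<in> V"
  obtains p q where "dom v p q" "p \<in> S"
  using vertex_crit[OF assms] dom_meets_S dom_commute by metis

lemma dom_left_A:
  assumes "dom v p q" "p \<in> A" "b \<in> B" "b \<noteq> v" shows "q \<in> S" "E q b"
proof -
  have ne: "b \<noteq> p" "\<not> E p b" "b \<in> V" using assms sep disj V_eq by blast+
  show "q \<in> S" using dom_meets_S[OF assms(1)] assms(2) disj by blast
  then have "b \<noteq> q" using assms disj by blast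
  then show "E q b" using dom_covers[OF assms(1), of b] ne assms by blast
qed

lemma dom_left_B:
  assumes "dom v p q" "p \<in> B" "a \<in> A" "a \<noteq> v" shows "q \<in> S" "E q a"
  using split_graph.dom_left_A[OF flip assms] by auto

end

section \<open>An independent set of the size of the cut, and the arcs between its vertices\<close>

locale split_graph_indep = split_graph +
  fixes I :: "'a set"
  assumes I_sub: "I \<subseteq> V"
    and I_indep: "u \<in> I \<Longrightarrow> v \<in> I \<Longrightarrow> \<not> E u v"
    and I_card: "card I = card S"
    and tournament: "u \<in> I \<Longrightarrow> v \<in> I \<Longrightarrow> u \<noteq> v \<Longrightarrow>
           (\<exists>w. dominates_but V E v u w) \<or> (\<exists>w. dominates_but V E u v w)"
begin

lemma flip_indep: "split_graph_indep V E S B A I"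
proof -
  interpret F: split_graph V E S B A by (rule flip)
  show ?thesis
    by unfold_locales (use I_sub I_indep I_card tournament in blast)+
qed

definition misses_only :: "'a \<Rightarrow> 'a \<Rightarrow> bool" where
  "misses_only y v \<longleftrightarrow> v \<in> I \<and> (\<forall>x\<in>I. E y x \<longleftrightarrow> x \<noteq> v)"

lemma misses_only_unique: "misses_only y v \<Longrightarrow> misses_only y v' \<Longrightarrow> v = v'"
  unfolding misses_only_def by blast

lemma misses_onlyD: "misses_only y v \<Longrightarrow> x \<in> I \<Longrightarrow> x \<noteq> v \<Longrightarrow> E y x \<and> E x y"
  unfolding misses_only_def using sym by blast

lemma misses_onlyD2: "misses_only y v \<Longrightarrow> \<not> E y v \<and> \<not> E v y"
  unfolding misses_only_def using sym by blast

text \<open>For \<open>u\<close>, \<open>v\<close> in \<open>I\<close>, \<open>dom v u w\<close> is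
  an arc from \<open>u\<close> to \<open>v\<close> with partner \<open>w\<close>. As
  \<open>u\<close> has no neighbour in \<open>I\<close>, the partner alone dominates the rest of
  \<open>I\<close>.\<close>

lemma arc_misses_only:
  assumes "dom v u w" "u \<in> I" "v \<in> I"
  shows "w \<notin> I" "misses_only w v"
proof -
  show w: "w \<notin> I" using domD(6)[OF assms(1)] assms(2) I_indep by blast
  show "misses_only w v"
    unfolding misses_only_def
  proof (intro conjI ballI)
    show "v \<in> I" by fact
    fix x assume x: "x \<in> I"
    show "E w x \<longleftrightarrow> x \<noteq> v"
      using domD[OF assms(1)] dom_covers[OF assms(1), of x] x w I_indep assms I_sub by blast
  qed
qed

abbreviation T where "T \<equiv> I - S"
abbreviation J where "J \<equiv> I \<inter> S"
abbreviation Y where "Y \<equiv> S - I"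

lemma S_sub: "S \<subseteq> V" using V_eq by blast

lemma finI: "finite I" and finS: "finite S"
  using finV I_sub S_sub finite_subset by blast+

lemma card_Y: "card Y = card T"
proof -
  have "card I = card J + card T" "card S = card J + card Y"
    using card_Un_disjoint[of J T] card_Un_disjoint[of J Y] finI finS
    by (metis Int_Diff_Un Int_Diff_disjoint finite_Diff finite_Int Int_commute)+
  then show ?thesis using I_card by simp
qed

lemma arc_from_T:
  assumes "dom v u w" "u \<in> T" "v \<in> I"
  shows "w \<in> Y" "misses_only w v"
  using arc_misses_only[OF assms(1) _ assms(3)] dom_meets_S[OF assms(1)] assms(2) by blast+

text \<open>Otherwise equal cardinalities force \<open>I = S\<close>, so \<open>S\<close> is
  independent. In a critical pair of a vertex of \<open>A\<close> the member outside
  \<open>S\<close> is then adjacent to all of \<open>S\<close>, which leaves no critical pair for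
  that member.\<close>

lemma T_nonempty: "T \<noteq> {}"
proof
  assume "T = {}"
  then have IS: "I = S" using finS I_card by (metis Diff_eq_empty_iff card_subset_eq)
  obtain v where v: "v \<in> A" using nonempty by blast
  then obtain p q where pq: "dom v p q" "p \<in> S" using crit_pair_in_S[of "v"] V_eq by blast
  have q: "q \<notin> S" using domD[OF pq(1)] pq I_indep IS by blast
  have adj: "E q s" if "s \<in> S" for s
    using dom_covers[OF pq(1), of s] domD[OF pq(1)] that pq q I_indep IS S_sub v disj by blast
  obtain p' q' where "dom q p' q'" "p' \<in> S" using crit_pair_in_S[of "q"] domD(3)[OF pq(1)] by blast
  then show False using adj domD(11) by blast
qed

lemma outside_I: "\<exists>b\<in>B. b \<notin> I" "\<exists>a\<in>A. a \<notin> I"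
  using nonempty no_isolated I_indep sep sym by blast+

text \<open>Since \<open>v\<close> lies outside \<open>S\<close>, \<open>y\<close> is adjacent to
  all of \<open>J\<close>, whereas members of its critical pairs are not adjacent to it.\<close>

lemma crit_pair_in_Y:
  assumes "y \<in> Y" "misses_only y v" "v \<in> T" "dom y p q" "p \<in> S"
  shows "p \<in> Y" "p \<noteq> y" "\<not> E y p"
proof -
  show "p \<noteq> y" "\<not> E y p" using domD[OF assms(4)] by blast+
  then show "p \<in> Y" using misses_onlyD[OF assms(2), of p] assms(3,5) by blast
qed

text \<open>\<open>w\<close> and \<open>y\<close> miss different vertices, so they differ. As
  \<open>v\<close> is not adjacent to \<open>y\<close>, only \<open>w\<close> can dominate
  \<open>y\<close>.\<close>

lemma arc_via_adjacent:
  assumes "dom v' v w" "v \<in> I" "v' \<in> I" "misses_only y v" "y \<in> Y"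
  shows "E w y"
proof (rule dom_covers[OF assms(1)])
  have "v \<noteq> v'" using domD[OF assms(1)] by blast
  then show "y \<noteq> w" using arc_misses_only[OF assms(1-3)] misses_only_unique assms(4) by blast
  show "y \<in> V" "y \<noteq> v'" "y \<noteq> v" using assms S_sub by blast+
  show "\<not> E v y" using misses_onlyD2[OF assms(4)] by blast
qed

text \<open>If every vertex of \<open>T\<close> were the head of an arc from \<open>T\<close>, the
  partners would exhaust \<open>Y\<close>, because \<open>card Y = card T\<close>.\<close>

lemma source_exists: "\<exists>x\<in>T. \<forall>u\<in>T. \<forall>w. \<not> dom x u w"
proof (rule ccontr)
  assume "\<not> ?thesis"
  then have "\<forall>x\<in>T. \<exists>y. y \<in> Y \<and> misses_only y x"
    using arc_from_T by blast
  then obtain y where y: "\<And>v. v \<in> T \<Longrightarrow> y v \<in> Y \<and> misses_only (y v) v" by metis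
  have inj: "inj_on y T" using y misses_only_unique by (metis inj_onI)
  have img: "y ` T = Y"
    by (rule card_subset_eq) (use y finS card_image[OF inj] card_Y in auto)
  \<comment> \<open>An arc from \<open>a\<close> to \<open>b\<close> must have partner
    \<open>y b\<close>, and \<open>arc_via_adjacent\<close> makes this adjacent to
    \<open>y a\<close>. So \<open>Y\<close> is a clique, which leaves no critical pair for
    \<open>y v\<close>.\<close>
  have adj: "E (y v) (y v')" if "v \<in> T" "v' \<in> T" "v \<noteq> v'" for v v'
  proof -
    have *: "E (y b) (y a)" if "dom b a w" "a \<in> T" "b \<in> T" for a b w
    proof -
      have w: "w \<in> Y" "misses_only w b" using arc_from_T[OF that(1)] that(2,3) by blast+
      then obtain u where u: "u \<in> T" "w = y u" using img by blast
      then have "u = b" using misses_only_unique[of w u b] w(2) y[OF u(1)] by simp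
      then show ?thesis using arc_via_adjacent[OF that(1)] y[OF that(2)] u that(2,3) by simp
    qed
    show ?thesis using tournament[of v v'] that * sym by blast
  qed
  obtain v where v: "v \<in> T" using T_nonempty by blast
  obtain p q where pq: "dom (y v) p q" "p \<in> S" using crit_pair_in_S[of "y v"] y[OF v] S_sub by blast
  have "p \<in> Y" "p \<noteq> y v" "\<not> E (y v) p" using crit_pair_in_Y[OF _ _ v pq] y[OF v] by simp_all
  moreover from this obtain v' where "v' \<in> T" "p = y v'" using img by blast
  ultimately show False using adj[OF v, of v'] by auto
qed

end

section \<open>The configuration around a source \<open>x\<close> of the arcs within
  \<open>T\<close>\<close>

text \<open>\<open>y v\<close> is the partner in the arc from \<open>x\<close> to \<open>v\<close>.
  As \<open>card Y = card T\<close>, these partners fill \<open>Y\<close> up to one vertex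
  \<open>z\<close>.\<close>

locale sourced_split = split_graph_indep +
  fixes x z :: 'a and y :: "'a \<Rightarrow> 'a"
  assumes xT: "x \<in> I" "x \<notin> S" and xA: "x \<in> A"
    and y_arc: "v \<in> T - {x} \<Longrightarrow> dominates_but V E v x (y v)"
    and Y_eq: "Y = insert z (y ` (T - {x}))"
    and z_new: "z \<notin> y ` (T - {x})"
begin

abbreviation T' where "T' \<equiv> T - {x}"

lemma x_in: "x \<in> T" using xT by blast

lemma y_props:
  assumes "v \<in> T'" shows "y v \<in> Y" "y v \<in> S" "y v \<notin> I" "y v \<noteq> z" "misses_only (y v) v"
    "E (y v) x" "E x (y v)" "v \<noteq> x" "v \<in> I" "v \<in> T"
  using assms Y_eq z_new arc_from_T(2)[OF y_arc[OF assms] x_in] domD[OF y_arc[OF assms]] by blast+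

lemma z_props: "z \<in> Y" "z \<in> S" "z \<notin> I" "z \<in> V"
  using Y_eq S_sub by blast+

lemma Y_cases: "p \<in> Y \<Longrightarrow> p = z \<or> (\<exists>v\<in>T'. p = y v)"
  using Y_eq by blast

lemma y_eqI:
  assumes "misses_only (y u) v" "u \<in> T'" shows "u = v"
  using misses_only_unique[OF y_props(5)[OF assms(2)] assms(1)] .

lemma Y_misses_only:
  assumes "p \<in> Y" "misses_only p v" shows "p = z \<or> (v \<in> T' \<and> p = y v)"
proof (cases "p = z")
  case False
  then obtain u where u: "u \<in> T'" "p = y u" using Y_cases assms(1) by blast
  then have "u = v" using y_eqI assms(2) by blast
  then show ?thesis using u by blast
qed blast

lemma x_covers: "v \<in> T' \<Longrightarrow> q \<in> V \<Longrightarrow> q \<noteq> v \<Longrightarrow> q \<noteq> x \<Longrightarrow> q \<noteq> y v \<Longrightarrow> \<not> E (y v) q \<Longrightarrow> E x q"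
  using dom_covers[OF dom_commute[OF y_arc]] by blast

lemma y_covers_B: "v \<in> T' \<Longrightarrow> b \<in> B \<Longrightarrow> b \<noteq> v \<Longrightarrow> E (y v) b"
  using dom_left_A[OF y_arc xA] by blast

lemma T_single_False:
  assumes "T = {x}" shows False
proof -
  have Yz: "Y = {z}" and JS: "S = insert z J" using Y_eq assms by auto
  \<comment> \<open>A critical pair of \<open>w\<close> can use no vertex of \<open>J\<close>, so it
    uses \<open>z\<close>.\<close>
  have away: "\<not> E w z" if w: "w \<in> V" "w \<notin> S" "\<forall>j\<in>J. E w j" for w
  proof -
    obtain p q where pq: "dom w p q" "p \<in> S" using crit_pair_in_S[of "w"] w by blast
    then have "p \<notin> J" using domD[OF pq(1)] w by blast
    then have "p = z" using JS pq(2) by blast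
    then show ?thesis using domD[OF pq(1)] by blast
  qed
  obtain j0 q0 where jq: "dom z j0 q0" "j0 \<in> S" using crit_pair_in_S[of "z"] z_props by blast
  have j0: "j0 \<in> J" "\<not> E j0 z" "\<not> E z j0" using domD[OF jq(1)] JS jq(2) by blast+
  \<comment> \<open>An arc from \<open>x\<close> to \<open>j\<close> has its partner in
    \<open>Y = {z}\<close>. The partner of an arc from \<open>j\<close> to \<open>x\<close> is
    adjacent to all of \<open>J\<close>, hence differs from \<open>z\<close> because of
    \<open>j0\<close> and is not adjacent to \<open>z\<close> by \<open>away\<close>; so
    \<open>j\<close> dominates \<open>z\<close>.\<close>
  have arcs: "dom j x z \<or> (\<exists>w. dom x j w \<and> w \<notin> S \<and> \<not> E w z \<and> E j z)" if j: "j \<in> J" for j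
  proof -
    have "j \<noteq> x" using j xT by blast
    then consider w where "dom j x w" | w where "dom x j w" using tournament[of x j] j xT by blast
    then show ?thesis
    proof cases
      case (1 w)
      then have "w = z" using arc_from_T(1)[OF 1 x_in] j Yz by blast
      then show ?thesis using 1 by simp
    next
      case (2 w)
      have w: "w \<notin> I" "misses_only w x" using arc_misses_only[OF 2] j xT by blast+
      have wS: "w \<notin> S"
      proof
        assume "w \<in> S"
        then have "w = z" using w Yz by blast
        then show False using w(2) j0 misses_onlyD[of z x j0] xT by blast
      qed
      have nz: "\<not> E w z"
        using away[of w] domD[OF 2] wS misses_onlyD[OF w(2)] xT by blast
      have "E j z"
        by (rule dom_covers[OF dom_commute[OF 2]])
          (use z_props xT j wS nz in blast)+
      then show ?thesis using 2 wS nz by blast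
    qed
  qed
  have xz: "dom j0 x z" using arcs[OF j0(1)] j0 by blast
  have zB: "E z b" if "b \<in> B" for b using dom_left_A[OF xz xA that] that j0 disj by blast
  obtain b where b: "b \<in> B" using nonempty by blast
  obtain p q where pq: "dom b p q" "p \<in> S" using crit_pair_in_S[of "b"] b V_eq by blast
  have pz: "p \<noteq> z" "q \<noteq> z" using domD[OF pq(1)] zB[OF b] by blast+
  have p: "p \<in> J" using pz pq(2) JS by blast
  have q: "q \<notin> S" "q \<notin> I" using pz domD[OF pq(1)] p JS I_indep by blast+
  have bx: "b \<notin> S" using b disj by blast
  \<comment> \<open>\<open>p\<close> lies in the independent set \<open>J\<close>, so
    \<open>q\<close> dominates the rest of \<open>J\<close>; by \<open>away\<close>,
    \<open>z\<close> is then left to \<open>p\<close>.\<close>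
  have qJ: "E q j" if "j \<in> J" for j
  proof (cases "j = p")
    case True then show ?thesis using domD[OF pq(1)] by blast
  next
    case False
    then show ?thesis using dom_covers[OF pq(1), of j] that p q bx I_indep S_sub by blast
  qed
  have qz: "\<not> E q z" using away qJ q domD[OF pq(1)] by blast
  have "E p z"
    using dom_covers[OF dom_commute[OF pq(1)], of z] pz qz z_props bx by blast
  then have "\<not> dom p x z" using domD(12) sym by blast
  then obtain w where w: "dom x p w" "w \<notin> S" "\<not> E w z" using arcs[OF p] by blast
  \<comment> \<open>\<open>w\<close> fits on neither side: in \<open>A\<close> it would leave
    \<open>b\<close> to \<open>p\<close>, in \<open>B\<close> it would be adjacent to
    \<open>z\<close>.\<close>
  show False
  proof (cases "w \<in> A")
    case True
    have "E p b" using dom_left_A[OF dom_commute[OF w(1)] True b] b xA disj by blast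
    then show False using domD[OF pq(1)] by blast
  next
    case False
    then have "w \<in> B" using w domD(3)[OF w(1)] V_eq by blast
    then show False using zB w sym by blast
  qed
qed

lemma y_crit_in_Y:
  assumes "v \<in> T'" "dom (y v) p q" "p \<in> S"
  shows "p \<in> Y" "p \<noteq> y v" "\<not> E (y v) p"
  using crit_pair_in_Y[of "y v" v p q] assms y_props[OF assms(1)] by blast+

text \<open>By \<open>arc_via_adjacent\<close>, an arc whose partner is \<open>y\<close> of its head
  would make \<open>y v\<close> and \<open>y v'\<close> adjacent; \<open>z\<close> is the only other
  possible partner.\<close>

lemma nonadj_y_arc:
  assumes "v \<in> T'" "v' \<in> T'" "v \<noteq> v'" "\<not> E (y v) (y v')"
  shows "dom v' v z \<or> dom v v' z"
proof -
  have *: "w = z" if "dom b a w" "a \<in> T'" "b \<in> T'" "\<not> E (y b) (y a)" for a b w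
  proof (rule ccontr)
    assume "w \<noteq> z"
    have "w \<in> Y" "misses_only w b" using arc_from_T[OF that(1)] that by blast+
    then have "w = y b" using Y_misses_only \<open>w \<noteq> z\<close> by blast
    then show False
      using arc_via_adjacent[OF that(1) _ _ y_props(5,1)[OF that(2)]] that by simp
  qed
  have "\<not> E (y v') (y v)" using assms(4) sym by blast
  moreover have "(\<exists>w. dom v' v w) \<or> (\<exists>w. dom v v' w)" using tournament assms by blast
  ultimately show ?thesis using *[of v' v] *[of v v'] assms by metis
qed

text \<open>A member in \<open>S\<close> is a nonneighbour of \<open>y v\<close> in
  \<open>Y\<close>, hence is \<open>z\<close>, and the other member avoids \<open>S\<close>. Not
  being dominated by \<open>y v\<close>, it is \<open>v\<close> or a neighbour of
  \<open>x\<close>.\<close>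

lemma crit_pair_of_y:
  assumes "v \<in> T'" "\<forall>v'\<in>T'. v \<noteq> v' \<longrightarrow> E (y v) (y v')"
  obtains q where "dom (y v) z q" "q \<notin> S" "q = v \<or> q \<in> A" "\<not> E (y v) z"
proof -
  obtain p q where pq: "dom (y v) p q" "p \<in> S" using crit_pair_in_S[of "y v"] y_props[OF assms(1)] S_sub by blast
  have eqz: "p' = z" if p': "dom (y v) p' q'" "p' \<in> S" for p' q'
  proof (rule ccontr)
    assume "p' \<noteq> z"
    then obtain v' where "v' \<in> T'" "p' = y v'" using Y_cases y_crit_in_Y(1)[OF assms(1) p'] by blast
    moreover from this have "v \<noteq> v'" using y_crit_in_Y(2)[OF assms(1) p'] by blast
    ultimately show False using y_crit_in_Y(3)[OF assms(1) p'] assms(2) by blast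
  qed
  have p: "p = z" by (rule eqz[OF pq])
  have q: "q \<notin> S" using eqz[OF dom_commute[OF pq(1)]] p domD(8)[OF pq(1)] by auto
  have "q \<in> A" if "q \<noteq> v"
  proof -
    have "q \<noteq> x" "q \<noteq> y v" "\<not> E (y v) q" "q \<in> V"
      using domD(3,5,10,12)[OF pq(1)] y_props(6,7)[OF assms(1)] by blast+
    then show ?thesis using x_covers[OF assms(1), of q] edge_in_A[of x q] xA that q by blast
  qed
  then show ?thesis using that[of q] pq(1)[unfolded p] q domD(11)[OF pq(1)[unfolded p]] by blast
qed

text \<open>If \<open>y v\<close> is adjacent to all other \<open>y v'\<close>, it is not adjacent
  to \<open>z\<close>, so \<open>x\<close> must dominate \<open>z\<close>. Otherwise
  \<open>z\<close> is the partner in an arc between vertices of \<open>T'\<close> and so misses a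
  vertex other than \<open>x\<close>.\<close>

lemma x_adj_z:
  assumes "v \<in> T'" shows "E x z"
proof (cases "\<forall>v'\<in>T'. v \<noteq> v' \<longrightarrow> E (y v) (y v')")
  case True
  then have "\<not> E (y v) z" using crit_pair_of_y[OF assms] by blast
  then show ?thesis
    using x_covers[OF assms, of z] z_props xT y_props[OF assms] by metis
next
  case False
  then obtain v' where "v' \<in> T'" "dom v' v z \<or> dom v v' z" using nonadj_y_arc assms by blast
  then have "misses_only z v' \<or> misses_only z v"
    using arc_misses_only(2)[of v' v z] arc_misses_only(2)[of v v' z] assms by blast
  then show ?thesis
    using misses_onlyD[of z v x] misses_onlyD[of z v' x] xT assms \<open>v' \<in> T'\<close> by blast
qed

lemma x_adj_Y:
  assumes "v \<in> T'" "p \<in> Y" shows "E x p"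
  using Y_cases[OF assms(2)] x_adj_z[OF assms(1)] y_props(7) by auto

text \<open>In an arc from \<open>x\<close> to \<open>j\<close> the partner is \<open>z\<close>,
  since each \<open>y u\<close> misses a vertex of \<open>T'\<close>. In an arc from
  \<open>j\<close> to \<open>x\<close> it misses \<open>x\<close>, whereas all of \<open>Y\<close>
  is adjacent to \<open>x\<close>.\<close>

lemma J_arc:
  assumes "v \<in> T'" "j \<in> J"
  shows "dom j x z \<or> (\<exists>w. dom x j w \<and> w \<notin> S \<and> misses_only w x)"
proof -
  have "j \<noteq> x" using assms xT by blast
  then consider w where "dom j x w" | w where "dom x j w" using tournament[of x j] assms xT by blast
  then show ?thesis
  proof cases
    case (1 w)
    then have "w \<in> Y" "misses_only w j" using arc_from_T[OF 1 x_in] assms by blast+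
    then have "w = z" using Y_misses_only assms(2) by blast
    then show ?thesis using 1 by blast
  next
    case (2 w)
    have w: "w \<notin> I" "misses_only w x" using arc_misses_only[OF 2] assms xT by blast+
    have "w \<notin> Y" using x_adj_Y[OF assms(1)] w(2) misses_onlyD2 by blast
    then show ?thesis using 2 w by blast
  qed
qed

text \<open>Neither member lies in \<open>Y\<close>, as both are nonneighbours of \<open>b\<close>;
  being adjacent, they do not both lie in \<open>J\<close>. As \<open>p\<close> has no neighbour in
  \<open>I\<close>, \<open>q\<close> dominates \<open>T\<close>.\<close>

lemma crit_pair_in_J:
  assumes "b \<notin> S" "\<forall>p\<in>Y. E p b" "dom b p q" "p \<in> S" "b \<notin> I"
  shows "p \<in> J" "q \<notin> S" "\<forall>u\<in>T. E q u"
proof -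
  show p: "p \<in> J" using domD[OF assms(3)] assms by blast
  show q: "q \<notin> S" using domD[OF assms(3)] assms p I_indep by blast
  have "q \<notin> I" using domD[OF assms(3)] p I_indep by blast
  then show "\<forall>u\<in>T. E q u"
    using dom_covers[OF assms(3)] p I_indep I_sub assms(5) by blast
qed

text \<open>Here \<open>Y\<close> is complete to \<open>B\<close>, so a critical pair of some
  \<open>b\<close> in \<open>B\<close> outside \<open>I\<close> uses a vertex \<open>p\<close> of
  \<open>J\<close>. Arcs between \<open>p\<close> and \<open>x\<close> and between \<open>p\<close>
  and \<open>v\<close> cannot coexist.\<close>

lemma T_in_A_False:
  assumes v: "v \<in> T'" and TA: "T \<subseteq> A" shows False
proof -
  have zB: "E z b" if b: "b \<in> B" for b
  proof (cases "\<forall>v1\<in>T'. v \<noteq> v1 \<longrightarrow> E (y v) (y v1)")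
    case True
    obtain q where q: "dom (y v) z q" "q = v \<or> q \<in> A" using crit_pair_of_y[OF v True] by blast
    then have "q \<in> A" using v TA by blast
    then show ?thesis using dom_left_A[OF dom_commute[OF q(1)] _ b] b y_props[OF v] disj by blast
  next
    case False
    then obtain v' where v': "v' \<in> T'" "dom v' v z \<or> dom v v' z" using nonadj_y_arc v by blast
    then have "v \<in> A" "v' \<in> A" using v TA by blast+
    moreover have "b \<noteq> v" "b \<noteq> v'" using calculation b disj by blast+
    ultimately show ?thesis using v' dom_left_A b by blast
  qed
  have YB: "E p b" if "p \<in> Y" "b \<in> B" for p b
    using Y_cases[OF that(1)] zB[OF that(2)] y_covers_B that TA disj by blast
  obtain b where b: "b \<in> B" "b \<notin> I" using outside_I by blast
  obtain p q where pq: "dom b p q" "p \<in> S" using crit_pair_in_S[of "b"] b V_eq by blast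
  have p: "p \<in> J" "\<not> E p b"
    using crit_pair_in_J(1)[OF _ _ pq b(2)] b disj YB domD[OF pq(1)] by blast+
  \<comment> \<open>Such a \<open>w\<close> would be adjacent to \<open>u'\<close>, hence lie in
    \<open>A\<close> and leave \<open>b\<close> to \<open>p\<close>.\<close>
  have reach: False if "dom u p w" "u \<in> T" "u' \<in> T" "u \<noteq> u'" "w \<notin> S" for u u' w
  proof -
    have "misses_only w u" using arc_misses_only[OF that(1)] p that by blast
    then have "E u' w" using misses_onlyD that by blast
    then have "w \<in> A" using edge_in_A that TA domD(3)[OF that(1)] by blast
    then have "E p b" using dom_left_A[OF dom_commute[OF that(1)]] b that TA disj by blast
    then show False using p by blast
  qed
  show False
  proof (cases "dom p x z")
    case False
    then show False using J_arc[OF v p(1)] reach[of x _ v] x_in y_props[OF v] by blast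
  next
    case True
    have zp: "misses_only z p" using arc_misses_only[OF True] xT p by blast
    \<comment> \<open>\<open>z\<close> misses \<open>p\<close>, so it is not the partner in an arc
      between vertices of \<open>T'\<close>.\<close>
    have "E (y v) (y v')" if "v' \<in> T'" "v \<noteq> v'" for v'
      using nonadj_y_arc[OF v that] arc_misses_only[of v v' z] arc_misses_only[of v' v z]
        y_props[OF v] y_props[OF that(1)] misses_only_unique[OF zp] p by blast
    then have nz: "\<not> E (y v) z" using crit_pair_of_y[OF v] by blast
    have "p \<noteq> v" using p v by blast
    then consider w where "dom p v w" | w where "dom v p w"
      using tournament[of v p] p y_props[OF v] by blast
    \<comment> \<open>In both cases \<open>arc_via_adjacent\<close> makes \<open>z\<close> adjacent
      to \<open>y v\<close>, against \<open>nz\<close>.\<close>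
    then show False
    proof cases
      case (1 w)
      have "w \<in> Y" "misses_only w p" using arc_from_T[OF 1] p y_props[OF v] by blast+
      then have "w = z" using Y_misses_only p by blast
      then show False using arc_via_adjacent[OF 1] y_props[OF v] p nz sym by blast
    next
      case (2 w)
      have w: "w \<notin> I" "misses_only w v" using arc_misses_only[OF 2] p y_props[OF v] by blast+
      have "w \<in> S" using reach[OF 2 _ x_in] y_props[OF v] by blast
      then have "w = z \<or> w = y v" using Y_misses_only w by blast
      moreover have "w \<noteq> z" using w(2) misses_only_unique[OF zp] \<open>p \<noteq> v\<close> by blast
      ultimately have "w = y v" by blast
      then show False using arc_via_adjacent[OF 2 _ _ zp] z_props y_props[OF v] p nz by blast
    qed
  qed
qed

text \<open>As \<open>T\<close> meets both sides, no vertex outside \<open>S\<close> is adjacent to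
  all of \<open>T\<close>. This restricts the critical pairs of vertices of \<open>A\<close> and
  \<open>B\<close> outside \<open>I\<close>.\<close>

lemma T_meets_B_False:
  assumes x2: "x2 \<in> T" "x2 \<in> B" shows False
proof -
  have x2': "x2 \<in> T'" using x2 xA disj by blast
  have zB: "\<not> E z b" if b: "b \<in> B" "b \<notin> I" for b
  proof
    assume "E z b"
    then have YB: "\<forall>p\<in>Y. E p b" using Y_cases y_covers_B b by blast
    obtain p q where pq: "dom b p q" "p \<in> S" using crit_pair_in_S[of "b"] b V_eq by blast
    have "b \<notin> S" using b disj by blast
    then have "q \<notin> S" "E q x" "E q x2" using crit_pair_in_J[OF _ YB pq b(2)] x_in x2 by blast+
    then show False using domD(3)[OF pq(1)] V_eq sep sym xA x2(2) by blast
  qed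
  obtain b where b: "b \<in> B" "b \<notin> I" using outside_I by blast
  obtain j q where jq: "dom x j q" "j \<in> S" using crit_pair_in_S[of "x"] xT I_sub by blast
  have j: "j \<in> J" using x_adj_Y[OF x2'] domD[OF jq(1)] jq(2) by blast
  have "\<not> dom j x z"
  proof
    assume "dom j x z"
    then have "E z b" using dom_left_A xA b j by blast
    then show False using zB b by blast
  qed
  then obtain w where w: "dom x j w" "w \<notin> S" "misses_only w x" using J_arc[OF x2' j] by blast
  have wadj: "E w u" if "u \<in> T'" for u using misses_onlyD[OF w(3)] that by blast
  \<comment> \<open>\<open>w\<close> is adjacent to all of \<open>T'\<close>, including
    \<open>x2\<close>, so it forces all of \<open>T'\<close> into \<open>B\<close>.\<close>
  have "w \<in> B" using wadj[OF x2'] edge_in_B x2 w(2) domD(3)[OF w(1)] sym by blast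
  then have T'B: "u \<in> B" if "u \<in> T'" for u using wadj[OF that] edge_in_B that I_sub by blast
  show False
  proof (cases "\<forall>v\<in>T'. \<forall>v'\<in>T'. v \<noteq> v' \<longrightarrow> E (y v) (y v')")
    case True
    have nz: "\<not> E (y v) z" if "v \<in> T'" for v using crit_pair_of_y[OF that] True that by blast
    obtain r where r: "dom (y x2) z r" "r = x2 \<or> r \<in> A"
      using crit_pair_of_y[OF x2'] True x2' by blast
    \<comment> \<open>An \<open>r\<close> in \<open>A\<close> would make \<open>z\<close> adjacent
      to \<open>b\<close>. So \<open>r = x2\<close>, and then \<open>z\<close> is adjacent to all of
      \<open>A\<close>.\<close>
    have "r \<notin> A" using dom_left_A[OF dom_commute[OF r(1)] _ b(1)] zB[OF b] b y_props[OF x2'] disj by blast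
    then have r2: "r \<in> B" using r x2 by blast
    have zA: "E z a" if "a \<in> A" for a
      using dom_left_B[OF dom_commute[OF r(1)] r2 that] that y_props[OF x2'] disj by blast
    obtain a where a: "a \<in> A" "a \<notin> I" using outside_I by blast
    have aS: "a \<notin> S" "a \<noteq> z" using a disj z_props by blast+
    \<comment> \<open>\<open>q\<close> would be adjacent to all of \<open>T\<close>, hence lie in
      \<open>S\<close>; but \<open>z\<close> is adjacent to \<open>a\<close>, and each
      \<open>y u\<close> misses \<open>u\<close>.\<close>
    have noJ: False if pq: "dom a p q" "p \<in> J" for p q
    proof -
      have qI: "q \<notin> I" using domD[OF pq(1)] pq(2) I_indep by blast
      have qT: "E q u" if "u \<in> T" for u
        using dom_covers[OF pq(1), of u] that pq(2) I_indep I_sub a qI by blast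
      have "q \<in> S" using qT[OF x_in] qT[OF x2(1)] domD(3)[OF pq(1)] V_eq sep sym xA x2(2) by blast
      then have "q \<in> Y" "q \<noteq> z" using qI domD[OF pq(1)] zA[OF a(1)] by blast+
      then obtain u where "u \<in> T'" "q = y u" using Y_cases by blast
      then show False using qT[of u] y_props[of u] misses_onlyD2 by blast
    qed
    obtain p q where pq: "dom a p q" "p \<in> S" using crit_pair_in_S[of "a"] a V_eq by blast
    have nJ: "p \<notin> J" "q \<notin> J" using noJ pq dom_commute by blast+
    have nez: "p \<noteq> z" "q \<noteq> z" using domD[OF pq(1)] zA[OF a(1)] by blast+
    obtain u where u: "u \<in> T'" "p = y u" using Y_cases nJ nez pq(2) by blast
    have qz: "E q z" using dom_covers[OF pq(1) z_props(4)] aS nez nz[OF u(1)] u(2) by blast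
    have qS: "q \<notin> S"
    proof
      assume "q \<in> S"
      then obtain u' where "u' \<in> T'" "q = y u'" using Y_cases nJ nez by blast
      then show False using nz qz by blast
    qed
    \<comment> \<open>As \<open>y u\<close> misses \<open>u\<close>, \<open>q\<close> dominates
      \<open>u\<close>. So \<open>q\<close> is a vertex of \<open>B\<close> outside \<open>I\<close>
      adjacent to \<open>z\<close>, against \<open>zB\<close>.\<close>
    have "q \<noteq> u" using domD[OF pq(1)] u y_props[OF u(1)] misses_onlyD2 by blast
    moreover have "u \<noteq> a" "u \<noteq> p" "u \<in> V"
      using u y_props(1,9)[OF u(1)] a I_sub by auto
    moreover have "\<not> E p u" using misses_onlyD2[OF y_props(5)[OF u(1)]] u(2) by simp
    ultimately have qu: "E q u" using dom_covers[OF pq(1), of u] by blast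
    have "q \<notin> I" using I_indep qu u by blast
    moreover have "q \<in> B" using edge_in_B[OF _ T'B[OF u(1)]] qu qS domD(3)[OF pq(1)] sym by blast
    ultimately show False using zB qz sym by blast
  next
    case False
    then obtain v1 v2 where v12: "v1 \<in> T'" "v2 \<in> T'" "v1 \<noteq> v2" "\<not> E (y v1) (y v2)" by blast
    then have "dom v2 v1 z \<or> dom v1 v2 z" using nonadj_y_arc by blast
    then obtain v v' where v: "v \<in> T'" "v' \<in> T'" "v \<noteq> v'" "dom v' v z"
      using v12 by blast
    have zv': "misses_only z v'" using arc_misses_only[OF v(4)] v by blast
    have zy: "E z (y v)" using arc_via_adjacent[OF v(4)] v y_props[OF v(1)] by blast
    \<comment> \<open>\<open>z\<close> is adjacent to \<open>y v\<close>, so the member is some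
      \<open>y u\<close> not adjacent to \<open>y v\<close>. By \<open>nonadj_y_arc\<close>,
      \<open>z\<close> then misses \<open>u\<close> or \<open>v\<close>; as it misses only
      \<open>v'\<close>, \<open>u = v'\<close>.\<close>
    have only: "p = y v'" if "dom (y v) p q" "p \<in> S" for p q
    proof -
      have p: "p \<in> Y" "p \<noteq> y v" "\<not> E (y v) p" using y_crit_in_Y[OF v(1) that] by blast+
      have "p \<noteq> z" using p zy sym by blast
      then obtain u where u: "u \<in> T'" "p = y u" using Y_cases p by blast
      then have "dom u v z \<or> dom v u z" using nonadj_y_arc[OF v(1) u(1)] p by blast
      then have "misses_only z u \<or> misses_only z v"
        using arc_misses_only[of u v z] arc_misses_only[of v u z] u v by blast
      then show ?thesis using misses_only_unique[OF zv'] v u by blast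
    qed
    obtain p q where pq: "dom (y v) p q" "p \<in> S"
      using crit_pair_in_S[of "y v"] y_props[OF v(1)] S_sub by blast
    have p: "p = y v'" using only pq by blast
    have q: "q \<notin> S" using only[OF dom_commute[OF pq(1)]] p domD[OF pq(1)] by blast
    have "q \<noteq> v'" using domD[OF pq(1)] p y_props[OF v(2)] misses_onlyD2 by blast
    moreover have "v' \<in> V" "v' \<noteq> y v" "v' \<noteq> p"
      using p y_props(3,9)[OF v(2)] y_props(3)[OF v(1)] I_sub by auto
    moreover have "\<not> E p v'" using misses_onlyD2[OF y_props(5)[OF v(2)]] p by simp
    ultimately have qv: "E q v'" using dom_covers[OF pq(1), of v'] by blast
    then have qB: "q \<in> B" using edge_in_B[OF _ T'B[OF v(2)]] q domD(3)[OF pq(1)] sym by blast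
    have "q \<noteq> v" using qv I_indep v by blast
    \<comment> \<open>\<open>y v\<close> does not dominate \<open>q\<close>, so \<open>x\<close>
      must, across the cut.\<close>
    then have "E x q" using x_covers[OF v(1), of q] domD[OF pq(1)] qB xA disj by blast
    then show False using sep xA qB by blast
  qed
qed

lemma contradiction: False
proof (cases "T = {x}")
  case True then show False by (rule T_single_False)
next
  case False
  then obtain v where v: "v \<in> T'" using x_in by blast
  show False
  proof (cases "T \<subseteq> A")
    case True then show False using T_in_A_False v by blast
  next
    case False
    then obtain x2 where "x2 \<in> T" "x2 \<in> B" using I_sub V_eq by blast
    then show False by (rule T_meets_B_False)
  qed
qed

end

section \<open>The source on either side of the cut\<close>

lemma (in split_graph_indep) contradiction_if_source_in_A:
  assumes x: "x \<in> T" "x \<in> A" and source: "\<forall>u\<in>T. \<forall>w. \<not> dom x u w"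
  shows False
proof -
  have "\<forall>v\<in>T - {x}. \<exists>w. dom v x w" using tournament source x by blast
  then obtain y where y: "\<And>v. v \<in> T - {x} \<Longrightarrow> dom v x (y v)" by metis
  have yY: "y v \<in> Y \<and> misses_only (y v) v" if "v \<in> T - {x}" for v
    using arc_from_T[OF y[OF that] x(1)] that by blast
  have inj: "inj_on y (T - {x})" using yY misses_only_unique by (metis inj_onI)
  have sub: "y ` (T - {x}) \<subseteq> Y" using yY by blast
  have cT: "card T = Suc (card (T - {x}))" using x finI by (metis card.remove finite_Diff)
  have "card (Y - y ` (T - {x})) = 1"
    using card_Diff_subset[OF _ sub] finI card_image[OF inj] card_Y cT by simp
  then obtain z where z: "Y - y ` (T - {x}) = {z}" by (metis card_1_singletonE)
  have "sourced_split V E S A B I x z y"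
    by (intro sourced_split.intro sourced_split_axioms.intro split_graph_indep_axioms)
      (use x y z sub in blast)+
  then show False by (rule sourced_split.contradiction)
qed

lemma (in split_graph_indep) inconsistent: False
proof -
  obtain x where x: "x \<in> T" "\<forall>u\<in>T. \<forall>w. \<not> dom x u w" using source_exists by blast
  show False
  proof (cases "x \<in> A")
    case True then show False using contradiction_if_source_in_A x by blast
  next
    case False
    then have "x \<in> B" using x I_sub V_eq by blast
    then show False using split_graph_indep.contradiction_if_source_in_A[OF flip_indep] x by blast
  qed
qed

section \<open>Cuts with two vertices\<close>

text \<open>Let \<open>S = {s, t}\<close> with \<open>t\<close> in a critical pair of a vertex of
  \<open>B\<close>. Then \<open>t\<close> is complete to \<open>A\<close>, so critical pairs of
  vertices of \<open>A\<close> use \<open>s\<close>, which thus has no neighbour in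
  \<open>A\<close>. The partner of \<open>s\<close> is pushed into \<open>B\<close> because
  \<open>A\<close> is a clique, and the rest of \<open>A\<close> stays undominated.\<close>

lemma (in split_graph) cut_pair_False:
  assumes S: "card S = 2"
    and no3: "\<And>u v w. u \<in> V \<Longrightarrow> v \<in> V \<Longrightarrow> w \<in> V \<Longrightarrow> u \<noteq> v \<Longrightarrow> u \<noteq> w \<Longrightarrow> v \<noteq> w \<Longrightarrow>
               E u v \<or> E u w \<or> E v w"
  shows False
proof -
  have one_side: "E s a \<or> E s b" if "s \<in> S" "a \<in> A" "b \<in> B" for s a b
  proof -
    have "s \<noteq> a" "s \<noteq> b" "a \<noteq> b" "s \<in> V" "a \<in> V" "b \<in> V" using that disj V_eq by blast+
    then show ?thesis using no3[of s a b] sep that by blast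
  qed
  obtain a0 b0 where ab: "a0 \<in> A" "b0 \<in> B" using nonempty by blast
  have clique: "E a a'" if "a \<in> A" "a' \<in> A" "a \<noteq> a'" for a a'
  proof -
    have "a \<noteq> b0" "a' \<noteq> b0" "a \<in> V" "a' \<in> V" "b0 \<in> V" using that ab disj V_eq by blast+
    then show ?thesis using no3[of a a' b0] sep that ab by blast
  qed
  obtain t q1 where t: "dom b0 t q1" "t \<in> S" using crit_pair_in_S[of b0] ab V_eq by blast
  have tA: "E t a" if "a \<in> A" for a using one_side[OF t(2) that ab(2)] domD(9)[OF t(1)] by blast
  have "card (S - {t}) = 1" using S t(2) by simp
  then obtain s where s: "S - {t} = {s}" by (metis card_1_singletonE)
  have missed: "\<not> E s a" if a: "a \<in> A" and d: "dom a p q" "p \<in> S" for a p q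
  proof -
    have "p \<noteq> t" using tA[OF a] domD(9)[OF d(1)] by blast
    then have "p = s" using s d(2) by blast
    then show ?thesis using domD(9)[OF d(1)] by blast
  qed
  have sA: "\<not> E s a" if a: "a \<in> A" for a
  proof -
    have "a \<in> V" using a V_eq by blast
    then obtain p q where "dom a p q" "p \<in> S" using crit_pair_in_S by blast
    then show ?thesis by (rule missed[OF a])
  qed
  obtain p q where pq: "dom a0 p q" "p \<in> S" using crit_pair_in_S[of a0] ab V_eq by blast
  have nt: "p \<noteq> t" "q \<noteq> t" using tA[OF ab(1)] domD(9,10)[OF pq(1)] by blast+
  have p: "p = s" using nt s pq(2) by blast
  have "q \<notin> S"
  proof
    assume "q \<in> S"
    then have "q \<in> S - {t}" using nt(2) by simp
    then show False using s p domD(8)[OF pq(1)] by simp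
  qed
  moreover have "q \<notin> A" using clique[of q a0] ab domD(5,10)[OF pq(1)] by blast
  ultimately have qB: "q \<in> B" using domD(3)[OF pq(1)] V_eq by blast
  obtain a where a: "a \<in> A" "a \<noteq> a0"
  proof -
    obtain u where "u \<in> A \<union> B" "E a0 u" using no_isolated ab by blast
    then have "u \<in> A" "u \<noteq> a0" using sep ab irr by blast+
    then show ?thesis using that by blast
  qed
  have "a \<in> V" "a \<noteq> p" "a \<noteq> q" using a qB pq(2) disj V_eq by blast+
  then have "E q a" using dom_covers[OF pq(1), of a] a sA p by blast
  then show False using sep sym a qB by blast
qed

section \<open>Connected sets and components\<close>

lemma conn_on_edge:
  assumes "E p q" "E q p" shows "conn_on E {p, q}"
proof -
  have "induced E {p, q} p q" "induced E {p, q} q p" using assms unfolding induced_def by auto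
  then show ?thesis unfolding conn_on_def by auto
qed

lemma conn_on_pairD:
  assumes "conn_on E {p, q}" "p \<noteq> q" shows "E p q"
proof -
  have "(induced E {p, q})\<^sup>*\<^sup>* p q" using assms unfolding conn_on_def by blast
  then obtain r where "induced E {p, q} p r" "r \<noteq> p" "r \<in> {p, q}"
    using assms(2)
  proof (induction rule: rtranclp_induct)
    case (step u w)
    then show ?case unfolding induced_def by (cases "u = p") auto
  qed simp
  then show ?thesis unfolding induced_def by auto
qed

lemma conn_on_singleton: "conn_on E {p}"
  unfolding conn_on_def by simp

lemma conn_on_neighbour:
  assumes "conn_on E W" "v \<in> W" "W \<noteq> {v}" shows "\<exists>w\<in>W. E v w"
proof -
  obtain u where u: "u \<in> W" "u \<noteq> v" using assms by blast
  then have "(induced E W)\<^sup>*\<^sup>* v u" using assms unfolding conn_on_def by blast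
  then obtain w where "induced E W v w" using u(2) by (metis converse_rtranclpE)
  then show ?thesis unfolding induced_def by blast
qed

lemma isolated_component:
  assumes "v \<in> W" "\<And>u. u \<in> W \<Longrightarrow> \<not> E v u" shows "is_component E W {v}"
  unfolding is_component_def
proof (intro conjI allI impI conn_on_singleton)
  show "{v} \<subseteq> W" using assms(1) by simp
  fix C assume C: "{v} \<subseteq> C \<and> C \<subseteq> W \<and> conn_on E C"
  show "C = {v}"
  proof (rule ccontr)
    assume "C \<noteq> {v}"
    then obtain u where "u \<in> C" "E v u" using conn_on_neighbour[of E C v] C by blast
    then show False using assms(2) C by blast
  qed
qed

lemma not_conn_on_split:
  assumes "W \<noteq> {}" "\<not> conn_on E W"
  obtains A B where "W = A \<union> B" "A \<inter> B = {}" "A \<noteq> {}" "B \<noteq> {}"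
    "\<And>a b. a \<in> A \<Longrightarrow> b \<in> B \<Longrightarrow> \<not> E a b"
proof -
  obtain u w where uw: "u \<in> W" "w \<in> W" "\<not> (induced E W)\<^sup>*\<^sup>* u w"
    using assms unfolding conn_on_def by blast
  let ?A = "{a \<in> W. (induced E W)\<^sup>*\<^sup>* u a}"
  show ?thesis
  proof (rule that[of ?A "W - ?A"])
    show "?A \<noteq> {}" "W - ?A \<noteq> {}" using uw by auto
    show "\<not> E a b" if "a \<in> ?A" "b \<in> W - ?A" for a b
    proof
      assume "E a b"
      then have "induced E W a b" using that unfolding induced_def by blast
      then show False using that by (auto intro: rtranclp.rtrancl_into_rtrancl)
    qed
  qed auto
qed

section \<open>Connected dominating sets with at most two vertices\<close>

lemma finite_conn_dom_cards:
  assumes "finite V" shows "finite {card D | D. conn_dom_set V E D}"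
proof -
  have "{card D | D. conn_dom_set V E D} \<subseteq> card ` Pow V" unfolding conn_dom_set_def by blast
  then show ?thesis using assms finite_subset by blast
qed

lemma gamma_c_le:
  assumes "finite V" "conn_dom_set V E D" shows "gamma_c V E \<le> card D"
  unfolding gamma_c_def using assms by (intro Min_le finite_conn_dom_cards) auto

lemma gamma_c_attained:
  assumes "finite V" "conn_on E V"
  obtains D where "conn_dom_set V E D" "card D = gamma_c V E"
proof -
  have "conn_dom_set V E V" using assms(2) unfolding conn_dom_set_def by blast
  then have "gamma_c V E \<in> {card D | D. conn_dom_set V E D}"
    unfolding gamma_c_def using assms by (intro Min_in finite_conn_dom_cards) auto
  then show ?thesis using that by auto
qed

lemma gamma_c_less_3:
  assumes "finite V" "conn_on E V" "gamma_c V E < 3"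
  obtains p where "p \<in> V" "\<forall>x\<in>V. x = p \<or> E p x"
    | p q where "p \<in> V" "q \<in> V" "p \<noteq> q" "E p q" "\<forall>x\<in>V. x = p \<or> x = q \<or> E p x \<or> E q x"
proof -
  obtain D where D: "conn_dom_set V E D" "card D < 3"
    using gamma_c_attained[OF assms(1,2)] assms(3) by metis
  have "finite D" "D \<noteq> {}" using D(1) assms(1) finite_subset
    unfolding conn_dom_set_def conn_on_def by blast+
  then have "card D \<noteq> 0" by simp
  then consider "card D = 1" | "card D = 2" using D(2) by linarith
  then show thesis
  proof cases
    case 1
    then obtain p where "D = {p}" by (metis card_1_singletonE)
    then show thesis using that(1)[of p] D(1) unfolding conn_dom_set_def by auto
  next
    case 2
    then obtain p q where pq: "D = {p, q}" "p \<noteq> q" by (meson card_2_iff)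
    then have "E p q" using D(1) conn_on_pairD unfolding conn_dom_set_def by fast
    then show thesis using that(2)[of p q] pq D(1) unfolding conn_dom_set_def by auto
  qed
qed

lemma conn_on_mono:
  assumes "conn_on E W" "\<And>u v. u \<in> W \<Longrightarrow> v \<in> W \<Longrightarrow> E u v \<Longrightarrow> F u v"
  shows "conn_on F W"
proof -
  have "induced E W \<le> induced F W" using assms(2) unfolding induced_def by blast
  then have "(induced E W)\<^sup>*\<^sup>* \<le> (induced F W)\<^sup>*\<^sup>*" by (rule rtranclp_mono)
  then show ?thesis using assms(1) unfolding conn_on_def by blast
qed

section \<open>From criticality to critical pairs\<close>

locale gamma3_graph =
  fixes V :: "'a set" and E :: "'a \<Rightarrow> 'a \<Rightarrow> bool"
  assumes simple: "simple_graph V E"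
    and conn: "conn_on E V"
    and gamma: "gamma_c V E = 3"
begin

lemma edgeD: "E x y \<Longrightarrow> x \<in> V \<and> y \<in> V \<and> x \<noteq> y \<and> E y x"
  using simple unfolding simple_graph_def by blast

lemma finite_V: "finite V"
  using simple unfolding simple_graph_def by blast

lemma no_dominating_edge:
  assumes "E p q" shows "\<exists>x\<in>V. x \<noteq> p \<and> x \<noteq> q \<and> \<not> E p x \<and> \<not> E q x"
proof (rule ccontr)
  assume "\<not> ?thesis"
  then have "conn_dom_set V E {p, q}"
    using edgeD[OF assms] conn_on_edge[of E p q] assms unfolding conn_dom_set_def by blast
  then have "3 \<le> card {p, q}" using gamma_c_le[OF finite_V] gamma by metis
  then show False using edgeD[OF assms] by simp
qed

text \<open>By \<open>no_dominating_edge\<close> some vertex is left out by \<open>pq\<close>, and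
  it can only be \<open>v\<close>.\<close>

lemma dominates_butI:
  assumes "E p q" "v \<in> V" "v \<noteq> p" "v \<noteq> q" "\<forall>x\<in>V. x = v \<or> x = p \<or> x = q \<or> E p x \<or> E q x"
  shows "dominates_but V E v p q"
proof -
  obtain x where "x \<in> V" "x \<noteq> p" "x \<noteq> q" "\<not> E p x" "\<not> E q x"
    using no_dominating_edge[OF assms(1)] by blast
  moreover from this have "x = v" using assms(5) by blast
  ultimately show ?thesis
    using assms edgeD[OF assms(1)] unfolding dominates_but_def by simp
qed

lemma no_dominating_vertex:
  assumes "p \<in> V" shows "\<exists>x\<in>V. x \<noteq> p \<and> \<not> E p x"
proof (rule ccontr)
  assume no: "\<not> ?thesis"
  have "V \<noteq> {p}"
  proof
    assume "V = {p}"
    then have "conn_dom_set V E {p}" unfolding conn_dom_set_def using conn by simp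
    then show False using gamma_c_le[OF finite_V] gamma by fastforce
  qed
  then obtain q where "q \<in> V" "E p q" using assms no by blast
  then show False using no_dominating_edge[of p q] no by blast
qed

lemma vertex_critical_pair:
  assumes "vertex_critical 3 V E" "v \<in> V"
  shows "\<exists>p q. dominates_but V E v p q"
proof -
  have "conn_on E (V - {v})" using assms unfolding vertex_critical_def k_connected_def by simp
  then have c: "conn_on (del_vertex E v) (V - {v})"
    by (rule conn_on_mono) (auto simp: del_vertex_def)
  have "gamma_c (V - {v}) (del_vertex E v) < 3" using assms unfolding vertex_critical_def by blast
  then show ?thesis
  proof (rule gamma_c_less_3[rotated 2])
    show "finite (V - {v})" using finite_V by simp
    show "conn_on (del_vertex E v) (V - {v})" by fact
  next
    fix p assume p: "p \<in> V - {v}" "\<forall>x\<in>V - {v}. x = p \<or> del_vertex E v p x"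
    \<comment> \<open>A vertex \<open>p\<close> dominating G - v would form a dominating edge of G
      with a neighbour \<open>w\<close> of \<open>v\<close>, or dominate G itself if
      \<open>w = p\<close>.\<close>
    then obtain w where w: "w \<in> V" "E v w" using conn_on_neighbour[OF conn assms(2)] by blast
    show ?thesis
    proof (cases "w = p")
      case True
      then show ?thesis using no_dominating_vertex[of p] p w edgeD[of v w] unfolding del_vertex_def by blast
    next
      case False
      then have "E p w" using p w edgeD[OF w(2)] unfolding del_vertex_def by blast
      then show ?thesis using no_dominating_edge[of p w] p w edgeD[OF w(2)] unfolding del_vertex_def by blast
    qed
  next
    fix p q assume "p \<in> V - {v}" "q \<in> V - {v}" "del_vertex E v p q"
      "\<forall>x\<in>V - {v}. x = p \<or> x = q \<or> del_vertex E v p x \<or> del_vertex E v q x"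
    then have "dominates_but V E v p q"
      using assms(2) unfolding del_vertex_def by (intro dominates_butI) blast+
    then show ?thesis by blast
  qed
qed

text \<open>The third vertex \<open>t\<close> prevents \<open>u\<close>, \<open>v\<close> and the
  new edge from dominating. A dominating vertex or edge avoiding \<open>u\<close> and
  \<open>v\<close> would already dominate G, so exactly one of \<open>u\<close>, \<open>v\<close> is
  used.\<close>

lemma edge_critical_pair:
  assumes "edge_critical 3 V E" "u \<in> V" "v \<in> V" "t \<in> V" "u \<noteq> v" "t \<noteq> u" "t \<noteq> v"
    "\<not> E u v" "\<not> E u t" "\<not> E v t"
  shows "(\<exists>w. dominates_but V E v u w) \<or> (\<exists>w. dominates_but V E u v w)"
proof -
  have new: "add_edge E u v p x \<longleftrightarrow> E p x" if "p \<noteq> u" "p \<noteq> v" for p x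
    using that unfolding add_edge_def by blast
  have endpoint: "dominates_but V E d c w"
    if cd: "c = u \<and> d = v \<or> c = v \<and> d = u" and w: "w \<in> V" "w \<noteq> c" "add_edge E u v c w"
      "\<forall>x\<in>V. x = c \<or> x = w \<or> add_edge E u v c x \<or> add_edge E u v w x" for c d w
  proof -
    have "w \<noteq> d"
    proof
      assume "w = d"
      then have "add_edge E u v c t \<or> add_edge E u v d t" using w(4) cd assms by blast
      then show False using cd assms unfolding add_edge_def by blast
    qed
    then show ?thesis
      using cd w assms by (intro dominates_butI) (auto simp: add_edge_def)
  qed
  have "conn_on (add_edge E u v) V"
    by (rule conn_on_mono[OF conn]) (auto simp: add_edge_def)
  moreover have "gamma_c V (add_edge E u v) < 3" using assms unfolding edge_critical_def by blast
  ultimately show ?thesis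
  proof (rule gamma_c_less_3[OF finite_V])
    fix p assume p: "p \<in> V" "\<forall>x\<in>V. x = p \<or> add_edge E u v p x"
    show ?thesis
    proof (cases "p = u \<or> p = v")
      case True
      then have "add_edge E u v p t" using p assms by blast
      then show ?thesis using True assms unfolding add_edge_def by blast
    next
      case False
      then show ?thesis using no_dominating_vertex[OF p(1)] p new by blast
    qed
  next
    fix p q assume pq: "p \<in> V" "q \<in> V" "p \<noteq> q" "add_edge E u v p q"
      "\<forall>x\<in>V. x = p \<or> x = q \<or> add_edge E u v p x \<or> add_edge E u v q x"
    have qp: "add_edge E u v q p" using pq(4) edgeD unfolding add_edge_def by blast
    consider "p = u \<or> p = v" | "q = u \<or> q = v" | "p \<noteq> u" "p \<noteq> v" "q \<noteq> u" "q \<noteq> v" by blast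
    then show ?thesis
    proof cases
      case 1
      then show ?thesis using endpoint[of p _ q] pq by metis
    next
      case 2
      then show ?thesis using endpoint[of q _ p] pq qp by metis
    next
      case 3
      then show ?thesis using no_dominating_edge[of p q] pq new by blast
    qed
  qed
qed

end

section \<open>The independence number and the final case distinction\<close>

lemma finite_indep_cards:
  assumes "finite V" shows "finite {card I | I. I \<subseteq> V \<and> independent E I}"
proof -
  have "{card I | I. I \<subseteq> V \<and> independent E I} \<subseteq> card ` Pow V" by blast
  then show ?thesis using assms finite_subset by blast
qed

lemma indep_number_ge:
  assumes "finite V" "I \<subseteq> V" "independent E I" shows "card I \<le> indep_number V E"
  unfolding indep_number_def using assms by (intro Max_ge finite_indep_cards) auto

lemma indep_number_attained:
  assumes "finite V"
  obtains I where "I \<subseteq> V" "independent E I" "card I = indep_number V E"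
proof -
  have "independent E {}" unfolding independent_def by blast
  then have "indep_number V E \<in> {card I | I. I \<subseteq> V \<and> independent E I}"
    unfolding indep_number_def using assms by (intro Max_in finite_indep_cards) auto
  then show ?thesis using that by auto
qed

theorem theorem4p6:
  fixes V :: "'a set" and E :: "'a \<Rightarrow> 'a \<Rightarrow> bool"
  assumes "simple_graph V E"
    and "conn_on E V"
    and "maximal_vertex_critical 3 V E"
    and "indep_number V E = connectivity V E"
    and "vertex_cut V E S"
    and "card S = connectivity V E"
  shows "\<exists>C. is_component E (V - S) C \<and> card C = 1"
proof (rule ccontr)
  assume no_single: "\<not> ?thesis"
  have ec: "edge_critical 3 V E" and vc: "vertex_critical 3 V E"
    using assms(3) unfolding maximal_vertex_critical_def by auto
  interpret gamma3_graph V E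
    using assms(1,2) ec unfolding edge_critical_def by unfold_locales auto
  have cut: "S \<subseteq> V" "V - S \<noteq> {}" "\<not> conn_on E (V - S)"
    using assms(5) unfolding vertex_cut_def by auto
  obtain A B where AB: "V - S = A \<union> B" "A \<inter> B = {}" "A \<noteq> {}" "B \<noteq> {}"
    "\<And>a b. a \<in> A \<Longrightarrow> b \<in> B \<Longrightarrow> \<not> E a b"
    using not_conn_on_split[OF cut(2,3)] by blast
  have "\<exists>u\<in>A \<union> B. E v u" if v: "v \<in> A \<union> B" for v
  proof (rule ccontr)
    assume "\<not> ?thesis"
    then have "is_component E (V - S) {v}" using isolated_component[of v "V - S" E] v AB(1) by blast
    then show False using no_single by (metis is_singletonI is_singleton_altdef)
  qed
  then interpret split_graph V E S A B
    using AB cut(1) finite_V edgeD vertex_critical_pair[OF vc] by unfold_locales blast+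
  have alpha: "indep_number V E = card S" using assms(4,6) by simp
  have "\<not> card S < 2" using vc cut unfolding vertex_critical_def k_connected_def by blast
  then consider "card S = 2" | "card S \<ge> 3" by linarith
  then show False
  proof cases
    case 1
    show False
    proof (rule cut_pair_False[OF 1], rule ccontr)
      fix u v w assume uvw: "u \<in> V" "v \<in> V" "w \<in> V" "u \<noteq> v" "u \<noteq> w" "v \<noteq> w"
        and no: "\<not> (E u v \<or> E u w \<or> E v w)"
      have "independent E {u, v, w}" using no sym irr unfolding independent_def by blast
      then have "card {u, v, w} \<le> 2" using indep_number_ge[of V "{u, v, w}" E] finite_V uvw alpha 1 by simp
      then show False using uvw by simp
    qed
  next
    case 2
    obtain I where I: "I \<subseteq> V" "independent E I" "card I = card S"
      using indep_number_attained[OF finite_V] alpha by metis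
    \<comment> \<open>\<open>edge_critical_pair\<close> requires a third independent vertex, hence
      the separate treatment of \<open>card S = 2\<close>.\<close>
    have third: "\<exists>t\<in>I. t \<noteq> u \<and> t \<noteq> v" for u v
    proof (rule ccontr)
      assume "\<not> ?thesis"
      then have "I \<subseteq> {u, v}" by blast
      then have "card I \<le> card {u, v}" by (intro card_mono) auto
      also have "\<dots> \<le> 2" by (simp add: card_insert_if)
      finally show False using I(3) 2 by simp
    qed
    interpret split_graph_indep V E S A B I
    proof
      show "I \<subseteq> V" "card I = card S" by fact+
      show nonadj: "\<not> E u v" if "u \<in> I" "v \<in> I" for u v
        using I(2) that unfolding independent_def by blast
      show "(\<exists>w. dominates_but V E v u w) \<or> (\<exists>w. dominates_but V E u v w)"
        if "u \<in> I" "v \<in> I" "u \<noteq> v" for u v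
      proof -
        obtain t where "t \<in> I" "t \<noteq> u" "t \<noteq> v" using third by blast
        then show ?thesis using edge_critical_pair[OF ec, of u v t] that nonadj I(1) by blast
      qed
    qed
    show False by (rule inconsistent)
  qed
qed

end
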